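(* For every acute triangle $ABC$ with $a<b$ and $a<c$, letting $d(X)$ denote the signed distance from a point $X$ to line $BC$, we have $$d(X_{26})>d(X_{20})>d(X_{22})>d(X_{40})>d(X_{8})>d(X_9)>d(X_{10})>d(X_2)>d(X_{37})>d(X_1)>d(X_7)>d(X_{29})$$ $$>d(X_{33})>d(X_4)>d(X_{27})>d(X_{19})>d(X_{28})>d(X_{25})>d(X_{34})>d(X_{24})>d(X_{36})>d(X_{16}).$$ Equivalently, in the side order, $X_{26}\prec X_{20}\prec X_{22}\prec X_{40}\prec X_8\prec X_9\prec X_{10}\prec X_2\prec X_{37}\prec X_1\prec X_7\prec X_{29}\prec X_{33}\prec X_4\prec X_{27}\prec X_{19}\prec X_{28}\prec X_{25}\prec X_{34}\prec X_{24}\prec X_{36}\prec X_{16}$.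
   Context: $X_n$ denotes the $n$-th triangle center listed in Kimberling's Encyclopedia of Triangle Centers (ETC), given by barycentric coordinates in terms of $a=BC$, $b=CA$, $c=AB$. The signed distance $d(P)$ from a point $P$ to side $BC$ is the (Euclidean) distance from $P$ to line $BC$, taken positive if $P$ lies on the same side of $BC$ as $A$ and negative if on the opposite side. The side order is defined by: $P\prec Q$ if $d(P)>d(Q)$ in every acute triangle $ABC$ with smallest side $BC$ ($a<b$, $a<c$). *)

theory Defs
  imports Complex_Main
begin

text \<open>Triangle with side lengths a = BC, b = CA, c = AB.
  The angle at the vertex opposite the first side argument (law of cosines).\<close>
definition angA :: "real \<Rightarrow> real \<Rightarrow> real \<Rightarrow> real" where
  "angA a b c = arccos ((b^2 + c^2 - a^2) / (2 * b * c))"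

definition acute_triangle :: "real \<Rightarrow> real \<Rightarrow> real \<Rightarrow> bool" where
  "acute_triangle a b c \<longleftrightarrow> 0 < a \<and> 0 < b \<and> 0 < c \<and>
     a < b + c \<and> b < c + a \<and> c < a + b \<and>
     a^2 < b^2 + c^2 \<and> b^2 < c^2 + a^2 \<and> c^2 < a^2 + b^2"

text \<open>A triangle center is given by a barycentric center function f:
  the point with barycentrics f a b c : f b c a : f c a b.
  Cartesian model: B = (0,0), C = (a,0), A = (Ax, Ay) with Ay > 0.
  The signed distance to BC is then the y-coordinate of the point.\<close>
definition Ax :: "real \<Rightarrow> real \<Rightarrow> real \<Rightarrow> real" where
  "Ax a b c = (a^2 + c^2 - b^2) / (2 * a)"

definition Ay :: "real \<Rightarrow> real \<Rightarrow> real \<Rightarrow> real" where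
  "Ay a b c = sqrt (c^2 - (Ax a b c)^2)"

definition sdist :: "(real \<Rightarrow> real \<Rightarrow> real \<Rightarrow> real) \<Rightarrow> real \<Rightarrow> real \<Rightarrow> real \<Rightarrow> real" where
  "sdist f a b c =
     (let u = f a b c; v = f b c a; w = f c a b
      in (u * Ay a b c + v * 0 + w * 0) / (u + v + w))"

definition bary_of_tril :: "(real \<Rightarrow> real \<Rightarrow> real \<Rightarrow> real) \<Rightarrow> real \<Rightarrow> real \<Rightarrow> real \<Rightarrow> real" where
  "bary_of_tril g a b c = a * g a b c"

abbreviation "cA a b c \<equiv> cos (angA a b c)"
abbreviation "cB a b c \<equiv> cos (angA b c a)"
abbreviation "cC a b c \<equiv> cos (angA c a b)"

text \<open>ETC centers (barycentric center functions, first coordinate).\<close>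
definition X1 :: "real \<Rightarrow> real \<Rightarrow> real \<Rightarrow> real" where "X1 a b c = a"
definition X2 :: "real \<Rightarrow> real \<Rightarrow> real \<Rightarrow> real" where "X2 a b c = 1"
definition X4 :: "real \<Rightarrow> real \<Rightarrow> real \<Rightarrow> real" where
  "X4 a b c = 1 / (b^2 + c^2 - a^2)"
definition X7 :: "real \<Rightarrow> real \<Rightarrow> real \<Rightarrow> real" where "X7 a b c = 1 / (b + c - a)"
definition X8 :: "real \<Rightarrow> real \<Rightarrow> real \<Rightarrow> real" where "X8 a b c = b + c - a"
definition X9 :: "real \<Rightarrow> real \<Rightarrow> real \<Rightarrow> real" where "X9 a b c = a * (b + c - a)"
definition X10 :: "real \<Rightarrow> real \<Rightarrow> real \<Rightarrow> real" where "X10 a b c = b + c"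
definition X16 :: "real \<Rightarrow> real \<Rightarrow> real \<Rightarrow> real" where
  "X16 = bary_of_tril (\<lambda>a b c. sin (angA a b c - pi / 3))"
definition X19 :: "real \<Rightarrow> real \<Rightarrow> real \<Rightarrow> real" where
  "X19 = bary_of_tril (\<lambda>a b c. tan (angA a b c))"
definition X20 :: "real \<Rightarrow> real \<Rightarrow> real \<Rightarrow> real" where
  "X20 = bary_of_tril (\<lambda>a b c. cA a b c - cB a b c * cC a b c)"
definition X22 :: "real \<Rightarrow> real \<Rightarrow> real \<Rightarrow> real" where
  "X22 a b c = a^2 * (b^4 + c^4 - a^4)"
definition X24 :: "real \<Rightarrow> real \<Rightarrow> real \<Rightarrow> real" where
  "X24 = bary_of_tril (\<lambda>a b c. cos (2 * angA a b c) / cos (angA a b c))"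
definition X25 :: "real \<Rightarrow> real \<Rightarrow> real \<Rightarrow> real" where
  "X25 = bary_of_tril (\<lambda>a b c. sin (angA a b c) * tan (angA a b c))"
definition X26 :: "real \<Rightarrow> real \<Rightarrow> real \<Rightarrow> real" where
  "X26 = bary_of_tril (\<lambda>a b c. a * (b^2 * cos (2 * angA b c a) + c^2 * cos (2 * angA c a b)
                                      - a^2 * cos (2 * angA a b c)))"
definition X27 :: "real \<Rightarrow> real \<Rightarrow> real \<Rightarrow> real" where
  "X27 = bary_of_tril (\<lambda>a b c. (1 / cos (angA a b c)) / (b + c))"
definition X28 :: "real \<Rightarrow> real \<Rightarrow> real \<Rightarrow> real" where
  "X28 = bary_of_tril (\<lambda>a b c. tan (angA a b c) / (b + c))"
definition X29 :: "real \<Rightarrow> real \<Rightarrow> real \<Rightarrow> real" where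
  "X29 = bary_of_tril (\<lambda>a b c. (1 / cA a b c) / (cB a b c + cC a b c))"
definition X33 :: "real \<Rightarrow> real \<Rightarrow> real \<Rightarrow> real" where
  "X33 = bary_of_tril (\<lambda>a b c. 1 + 1 / cA a b c)"
definition X34 :: "real \<Rightarrow> real \<Rightarrow> real \<Rightarrow> real" where
  "X34 = bary_of_tril (\<lambda>a b c. 1 - 1 / cA a b c)"
definition X36 :: "real \<Rightarrow> real \<Rightarrow> real \<Rightarrow> real" where
  "X36 = bary_of_tril (\<lambda>a b c. 1 - 2 * cA a b c)"
definition X37 :: "real \<Rightarrow> real \<Rightarrow> real \<Rightarrow> real" where "X37 a b c = a * (b + c)"
definition X40 :: "real \<Rightarrow> real \<Rightarrow> real \<Rightarrow> real" where
  "X40 = bary_of_tril (\<lambda>a b c. cB a b c + cC a b c - cA a b c - 1)"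

end

theory Submission
  imports Defs
begin

text \<open>
  A center with barycentrics \<open>u : v : w\<close> has signed distance \<open>h u / (u + v + w)\<close>, \<open>h\<close> being the
  altitude from \<open>A\<close>, so a comparison of \<open>u : v : w\<close> with \<open>u' : v' : w'\<close> amounts to
  \<open>u' (v + w) < u (v' + w')\<close>. For most neighbours in the chain this already holds term by term,
  because \<open>a\<close> is the shortest side. The exceptions are of two kinds.

  \<open>X20\<close>, \<open>X22\<close>, \<open>X26\<close> lie on the Euler line: with \<open>x = b\<^sup>2 + c\<^sup>2 - a\<^sup>2\<close> and \<open>y\<close>, \<open>z\<close> cyclically, their
  first barycentric is \<open>\<alpha> - \<beta> y z\<close> with \<open>\<alpha>\<close>, \<open>\<beta>\<close> symmetric in \<open>x, y, z\<close>, and the comparison becomes a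
  symmetric inequality between positive numbers.

  For the pairs \<open>(X22, X40)\<close>, \<open>(X40, X8)\<close>, \<open>(X7, X29)\<close>, \<open>(X36, X16)\<close> one substitutes
  \<open>b = a + t + m\<close>, \<open>c = a + t - m\<close> with \<open>t > 0\<close>; the difference is then a polynomial in \<open>a\<close>, \<open>t\<close>, \<open>m\<^sup>2\<close> all of
  whose coefficients are nonnegative. For \<open>X16\<close>, whose coordinates involve the area and \<open>sqrt 3\<close>,
  this happens after squaring.
\<close>

text \<open>Heron's formula for four times the area.\<close>
definition area4 :: "real \<Rightarrow> real \<Rightarrow> real \<Rightarrow> real" where
  "area4 a b c = sqrt ((a + b + c) * (b + c - a) * (c + a - b) * (a + b - c))"

section \<open>Angle functions in terms of the sides and the area\<close>

lemma acute_triangle_rotate: "acute_triangle a b c \<Longrightarrow> acute_triangle b c a"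
  by (auto simp: acute_triangle_def add.commute)

lemma area4_rotate: "area4 b c a = area4 a b c"
  unfolding area4_def by (rule arg_cong[of _ _ sqrt]) algebra

lemma area4_pos: "acute_triangle a b c \<Longrightarrow> 0 < area4 a b c"
  by (simp add: acute_triangle_def area4_def)

lemma area4_square:
  assumes "acute_triangle a b c"
  shows "(area4 a b c)\<^sup>2 = (a + b + c) * (b + c - a) * (c + a - b) * (a + b - c)"
  using assms by (simp add: acute_triangle_def area4_def)

text \<open>\<open>cos\<close> undoes \<open>arccos\<close> only on [-1, 1]: acuteness bounds the
  quotient from below, and the triangle inequality in the form \<open>\<bar>b - c\<bar> < a\<close>
  bounds it from above.\<close>

lemma cos_angA:
  assumes "acute_triangle a b c"
  shows "cos (angA a b c) = (b\<^sup>2 + c\<^sup>2 - a\<^sup>2) / (2 * b * c)"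
proof -
  have *: "0 < b" "0 < c" "0 < b\<^sup>2 + c\<^sup>2 - a\<^sup>2" "b < c + a" "c < a + b" "0 < a"
    using assms by (auto simp: acute_triangle_def)
  have "0 \<le> (a - (b - c)) * (a + (b - c))"
    using * by (intro mult_nonneg_nonneg) auto
  then have "b\<^sup>2 + c\<^sup>2 - a\<^sup>2 \<le> 2 * b * c"
    by (simp add: algebra_simps power2_eq_square)
  moreover have "0 < 2 * b * c" using * by simp
  ultimately have "0 \<le> (b\<^sup>2 + c\<^sup>2 - a\<^sup>2) / (2 * b * c)" "(b\<^sup>2 + c\<^sup>2 - a\<^sup>2) / (2 * b * c) \<le> 1"
    using * by auto
  then show ?thesis
    unfolding angA_def by (intro cos_arccos) auto
qed

lemma sin_angA:
  assumes "acute_triangle a b c"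
  shows "sin (angA a b c) = area4 a b c / (2 * b * c)"
proof -
  have *: "0 < b" "0 < c" "0 < b\<^sup>2 + c\<^sup>2 - a\<^sup>2"
    using assms by (auto simp: acute_triangle_def)
  have "0 \<le> angA a b c \<and> angA a b c \<le> pi"
  proof -
    have "0 \<le> (b\<^sup>2 + c\<^sup>2 - a\<^sup>2) / (2 * b * c)" using * by simp
    moreover have "(b\<^sup>2 + c\<^sup>2 - a\<^sup>2) / (2 * b * c) \<le> 1"
      using cos_le_one[of "angA a b c"] by (simp add: cos_angA[OF assms])
    ultimately show ?thesis unfolding angA_def by (intro conjI arccos_lbound arccos_ubound) auto
  qed
  then have "0 \<le> sin (angA a b c)" by (intro sin_ge_zero) auto
  moreover have "(sin (angA a b c))\<^sup>2 = (area4 a b c / (2 * b * c))\<^sup>2"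
  proof -
    have "(sin (angA a b c))\<^sup>2 = 1 - ((b\<^sup>2 + c\<^sup>2 - a\<^sup>2) / (2 * b * c))\<^sup>2"
      by (simp add: sin_squared_eq cos_angA[OF assms])
    also have "\<dots> = ((2 * b * c)\<^sup>2 - (b\<^sup>2 + c\<^sup>2 - a\<^sup>2)\<^sup>2) / (2 * b * c)\<^sup>2"
      using * by (simp add: power_divide diff_divide_distrib[of "(2 * b * c)\<^sup>2"])
    \<comment> \<open>Heron's product is this difference of two squares, factored twice.\<close>
    also have "(2 * b * c)\<^sup>2 - (b\<^sup>2 + c\<^sup>2 - a\<^sup>2)\<^sup>2 = (area4 a b c)\<^sup>2"
      unfolding area4_square[OF assms] by algebra
    finally show ?thesis by (simp add: power_divide)
  qed
  moreover have "0 \<le> area4 a b c / (2 * b * c)"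
    using * area4_pos[OF assms] by simp
  ultimately show ?thesis by (simp add: power2_eq_iff_nonneg)
qed

lemma tan_angA:
  assumes "acute_triangle a b c"
  shows "tan (angA a b c) = area4 a b c / (b\<^sup>2 + c\<^sup>2 - a\<^sup>2)"
  using assms by (simp add: tan_def sin_angA cos_angA acute_triangle_def)

text \<open>The squares of \<open>2 * a * c * cos B\<close> and \<open>area4 a b c\<close> add up to
  that of \<open>2 * a * c\<close>. As the area is positive, \<open>Ax\<close> is strictly shorter
  than \<open>c\<close>, so the root is taken of a positive number.\<close>

lemma Ay_pos:
  assumes "acute_triangle a b c"
  shows "0 < Ay a b c"
proof -
  have "(a\<^sup>2 + c\<^sup>2 - b\<^sup>2)\<^sup>2 + (area4 a b c)\<^sup>2 = (2 * a * c)\<^sup>2"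
    unfolding area4_square[OF assms] by algebra
  moreover have "0 < a" "0 < (area4 a b c)\<^sup>2"
    using assms area4_pos[OF assms] by (auto simp: acute_triangle_def)
  ultimately have "0 < a" "(a\<^sup>2 + c\<^sup>2 - b\<^sup>2)\<^sup>2 < (2 * a * c)\<^sup>2"
    by linarith+
  then have "(Ax a b c)\<^sup>2 < c\<^sup>2"
    by (simp add: Ax_def power_divide power_mult_distrib pos_divide_less_eq mult.commute)
  then show ?thesis by (simp add: Ay_def)
qed

section \<open>Criteria for comparing signed distances\<close>

text \<open>Barycentrics are homogeneous, so a common factor cancels. It has to be invariant under
  rotation because the three coordinates are one function at rotated arguments; its sign is
  free.\<close>

lemma sdist_scale:
  assumes "acute_triangle a b c"
    and "\<And>a b c. acute_triangle a b c \<Longrightarrow> f a b c = k a b c * g a b c"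
    and "\<And>a b c. acute_triangle a b c \<Longrightarrow> k b c a = k a b c"
    and "\<And>a b c. acute_triangle a b c \<Longrightarrow> k a b c \<noteq> 0"
  shows "sdist f a b c = sdist g a b c"
proof -
  have ac: "acute_triangle b c a" "acute_triangle c a b"
    using assms(1) acute_triangle_rotate by blast+
  have "f a b c = k a b c * g a b c" "f b c a = k a b c * g b c a" "f c a b = k a b c * g c a b"
    using assms(2)[OF assms(1)] assms(2)[OF ac(1)] assms(2)[OF ac(2)]
      assms(3)[OF assms(1)] assms(3)[OF ac(1)] by simp_all
  then show ?thesis
    using assms(4)[OF assms(1)]
    by (simp add: sdist_def Let_def mult.assoc flip: distrib_left)
qed

lemma sdist_lessI:
  assumes "acute_triangle a b c"
    and "0 < f a b c + f b c a + f c a b" "0 < g a b c + g b c a + g c a b"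
    and "f a b c * (g b c a + g c a b) < g a b c * (f b c a + f c a b)"
  shows "sdist f a b c < sdist g a b c"
proof -
  have "f a b c / (f a b c + f b c a + f c a b) < g a b c / (g a b c + g b c a + g c a b)"
    using assms(2-4) by (simp add: divide_less_eq less_divide_eq) (simp add: algebra_simps)
  from mult_strict_right_mono[OF this Ay_pos[OF assms(1)]] show ?thesis
    by (simp add: sdist_def Let_def)
qed

lemma sdist_less_termwise:
  assumes "acute_triangle a b c"
    and "0 < f a b c + f b c a + f c a b" "0 < g a b c + g b c a + g c a b"
    and "f a b c * g b c a < g a b c * f b c a" "f a b c * g c a b < g a b c * f c a b"
  shows "sdist f a b c < sdist g a b c"
  using assms by (intro sdist_lessI) (simp_all add: distrib_left)

text \<open>Multiplying the coordinates by weights that are smallest at \<open>A\<close> pulls the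
  point towards BC. Positivity of the weight at \<open>A\<close> suffices, the other two being
  larger.\<close>

lemma sdist_less_multiplier:
  assumes "acute_triangle a b c"
    and "0 < g a b c" "0 < g b c a" "0 < g c a b"
    and f: "\<And>a b c. acute_triangle a b c \<Longrightarrow> f a b c = g a b c * h a b c"
    and "0 < h a b c" "h a b c < h b c a" "h a b c < h c a b"
  shows "sdist f a b c < sdist g a b c"
proof -
  have eq: "f a b c = g a b c * h a b c" "f b c a = g b c a * h b c a" "f c a b = g c a b * h c a b"
    using f assms(1) acute_triangle_rotate by blast+
  show ?thesis
    using assms by (intro sdist_less_termwise) (auto simp: eq intro!: add_pos_pos)
qed

section \<open>Algebraic barycentrics of the trigonometric centers\<close>

lemma sdist_X4: "sdist X4 = sdist (\<lambda>a b c. 1 / (b\<^sup>2 + c\<^sup>2 - a\<^sup>2))"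
  by (simp add: X4_def[abs_def])

lemma sdist_X27:
  assumes "acute_triangle a b c"
  shows "sdist X27 a b c = sdist (\<lambda>a b c. 1 / ((b\<^sup>2 + c\<^sup>2 - a\<^sup>2) * (b + c))) a b c"
  by (rule sdist_scale[OF assms, where k = "\<lambda>a b c. 2 * a * b * c"])
    (auto simp: X27_def bary_of_tril_def cos_angA acute_triangle_def)

lemma sdist_X19:
  assumes "acute_triangle a b c"
  shows "sdist X19 a b c = sdist (\<lambda>a b c. a / (b\<^sup>2 + c\<^sup>2 - a\<^sup>2)) a b c"
  by (rule sdist_scale[OF assms, where k = area4])
    (auto simp: X19_def bary_of_tril_def tan_angA area4_rotate dest: area4_pos)

lemma sdist_X28:
  assumes "acute_triangle a b c"
  shows "sdist X28 a b c = sdist (\<lambda>a b c. a / ((b\<^sup>2 + c\<^sup>2 - a\<^sup>2) * (b + c))) a b c"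
  by (rule sdist_scale[OF assms, where k = area4])
    (auto simp: X28_def bary_of_tril_def tan_angA area4_rotate dest: area4_pos)

lemma sdist_X25:
  assumes "acute_triangle a b c"
  shows "sdist X25 a b c = sdist (\<lambda>a b c. a\<^sup>2 / (b\<^sup>2 + c\<^sup>2 - a\<^sup>2)) a b c"
proof (rule sdist_scale[OF assms, where k = "\<lambda>a b c. (area4 a b c)\<^sup>2 / (2 * a * b * c)"])
  fix a b c :: real assume ac: "acute_triangle a b c"
  then have pos: "0 < a" "0 < b" "0 < c" by (auto simp: acute_triangle_def)
  show "X25 a b c = (area4 a b c)\<^sup>2 / (2 * a * b * c) * (a\<^sup>2 / (b\<^sup>2 + c\<^sup>2 - a\<^sup>2))"
    using pos by (simp add: X25_def bary_of_tril_def sin_angA[OF ac] tan_angA[OF ac] power2_eq_square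
        mult.commute mult.left_commute)
  show "(area4 b c a)\<^sup>2 / (2 * b * c * a) = (area4 a b c)\<^sup>2 / (2 * a * b * c)"
    by (simp add: area4_rotate mult.commute mult.left_commute)
  show "(area4 a b c)\<^sup>2 / (2 * a * b * c) \<noteq> 0"
    using pos area4_pos[OF ac] by simp
qed

lemma sdist_X29:
  assumes "acute_triangle a b c"
  shows "sdist X29 a b c = sdist (\<lambda>a b c. (b + c - a) / ((b\<^sup>2 + c\<^sup>2 - a\<^sup>2) * (b + c))) a b c"
proof (rule sdist_scale[OF assms, where k = "\<lambda>a b c. (2 * a * b * c)\<^sup>2 /
      ((b + c - a) * (c + a - b) * (a + b - c))"])
  fix a b c :: real assume ac: "acute_triangle a b c"
  then have pos: "0 < a" "0 < b" "0 < c" "0 < b + c - a" "0 < c + a - b" "0 < a + b - c"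
    "0 < b\<^sup>2 + c\<^sup>2 - a\<^sup>2" by (auto simp: acute_triangle_def)
  \<comment> \<open>Over the denominator \<open>2 * a * b * c\<close> the numerator is
    \<open>(b + c) * (a\<^sup>2 - (b - c)\<^sup>2)\<close>. Below, \<open>b + c - a\<close> is
    inserted above and below the line to make the remaining factor rotation invariant.\<close>
  have "cB a b c + cC a b c = (b + c) * ((c + a - b) * (a + b - c)) / (2 * a * b * c)"
    using pos by (simp add: cos_angA acute_triangle_rotate[OF ac]
        acute_triangle_rotate[OF acute_triangle_rotate[OF ac]] divide_simps)
      algebra
  then have "X29 a b c = 2 * a * b * c / (b\<^sup>2 + c\<^sup>2 - a\<^sup>2) *
      (2 * a * b * c / ((b + c) * ((c + a - b) * (a + b - c))))"
    by (simp add: X29_def bary_of_tril_def cos_angA[OF ac])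
  also have "\<dots> = (2 * a * b * c)\<^sup>2 / ((b + c - a) * (c + a - b) * (a + b - c)) *
      ((b + c - a) / ((b\<^sup>2 + c\<^sup>2 - a\<^sup>2) * (b + c)))"
    using pos by (simp add: power2_eq_square)
  finally show "X29 a b c = \<dots>" .
  show "(2 * b * c * a)\<^sup>2 / ((c + a - b) * (a + b - c) * (b + c - a)) =
      (2 * a * b * c)\<^sup>2 / ((b + c - a) * (c + a - b) * (a + b - c))"
    by (simp add: mult.commute mult.left_commute)
  show "(2 * a * b * c)\<^sup>2 / ((b + c - a) * (c + a - b) * (a + b - c)) \<noteq> 0"
    using pos by simp
qed

lemma sdist_X33:
  assumes "acute_triangle a b c"
  shows "sdist X33 a b c = sdist (\<lambda>a b c. a * (b + c - a) / (b\<^sup>2 + c\<^sup>2 - a\<^sup>2)) a b c"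
proof (rule sdist_scale[OF assms, where k = "\<lambda>a b c. a + b + c"])
  fix a b c :: real assume ac: "acute_triangle a b c"
  then have pos: "0 < a" "0 < b" "0 < c" "0 < b\<^sup>2 + c\<^sup>2 - a\<^sup>2"
    by (auto simp: acute_triangle_def)
  then have "X33 a b c = a * ((b\<^sup>2 + c\<^sup>2 - a\<^sup>2 + 2 * b * c) / (b\<^sup>2 + c\<^sup>2 - a\<^sup>2))"
    by (simp add: X33_def bary_of_tril_def cos_angA[OF ac] add_divide_distrib[of "b\<^sup>2 + c\<^sup>2 - a\<^sup>2"])
  also have "b\<^sup>2 + c\<^sup>2 - a\<^sup>2 + 2 * b * c = (a + b + c) * (b + c - a)"
    by algebra
  finally show "X33 a b c = (a + b + c) * (a * (b + c - a) / (b\<^sup>2 + c\<^sup>2 - a\<^sup>2))"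
    by simp
qed (auto simp: acute_triangle_def)

text \<open>As for \<open>X33\<close>, the numerator of \<open>1 - 1 / cA a b c\<close> splits into
  linear factors. Completing them to a symmetric product puts \<open>b + c - a\<close> into the
  denominator; the negative sign is absorbed by the scaling.\<close>

lemma sdist_X34:
  assumes "acute_triangle a b c"
  shows "sdist X34 a b c = sdist (\<lambda>a b c. a / ((b\<^sup>2 + c\<^sup>2 - a\<^sup>2) * (b + c - a))) a b c"
proof (rule sdist_scale[OF assms, where k = "\<lambda>a b c. - ((b + c - a) * (c + a - b) * (a + b - c))"])
  fix a b c :: real assume ac: "acute_triangle a b c"
  then have pos: "0 < a" "0 < b" "0 < c" "0 < b + c - a" "0 < c + a - b" "0 < a + b - c"
    "0 < b\<^sup>2 + c\<^sup>2 - a\<^sup>2" by (auto simp: acute_triangle_def)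
  then have "X34 a b c = a * ((b\<^sup>2 + c\<^sup>2 - a\<^sup>2 - 2 * b * c) / (b\<^sup>2 + c\<^sup>2 - a\<^sup>2))"
    by (simp add: X34_def bary_of_tril_def cos_angA[OF ac] diff_divide_distrib[of "b\<^sup>2 + c\<^sup>2 - a\<^sup>2"])
  also have "b\<^sup>2 + c\<^sup>2 - a\<^sup>2 - 2 * b * c = - ((c + a - b) * (a + b - c))"
    by algebra
  finally show "X34 a b c = - ((b + c - a) * (c + a - b) * (a + b - c)) *
      (a / ((b\<^sup>2 + c\<^sup>2 - a\<^sup>2) * (b + c - a)))"
    using pos by simp
  show "- ((b + c - a) * (c + a - b) * (a + b - c)) \<noteq> 0"
    using pos by simp
qed simp

text \<open>The three cosines add up to \<open>1 + (b + c - a) * (c + a - b) * (a + b - c) / (2 * a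
  * b * c)\<close>, so the trilinear is this fraction minus \<open>2 * cA a b c\<close>. The factor
  is negative so that the new coordinates have a positive sum.\<close>

lemma sdist_X40:
  assumes "acute_triangle a b c"
  shows "sdist X40 a b c = sdist (\<lambda>a b c. 2 * a\<^sup>2 * (b\<^sup>2 + c\<^sup>2 - a\<^sup>2)
    - a * ((b + c - a) * (c + a - b) * (a + b - c))) a b c"
proof (rule sdist_scale[OF assms, where k = "\<lambda>a b c. - 1 / (2 * a * b * c)"])
  fix a b c :: real assume ac: "acute_triangle a b c"
  then have pos: "0 < a" "0 < b" "0 < c" by (auto simp: acute_triangle_def)
  then show "X40 a b c = - 1 / (2 * a * b * c) * (2 * a\<^sup>2 * (b\<^sup>2 + c\<^sup>2 - a\<^sup>2)
    - a * ((b + c - a) * (c + a - b) * (a + b - c)))"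
    by (simp add: X40_def bary_of_tril_def cos_angA ac acute_triangle_rotate[OF ac]
        acute_triangle_rotate[OF acute_triangle_rotate[OF ac]] divide_simps) algebra
qed (auto simp: acute_triangle_def)

lemma sdist_X16:
  assumes "acute_triangle a b c"
  shows "sdist X16 a b c =
    sdist (\<lambda>a b c. a\<^sup>2 * (area4 a b c - sqrt 3 * (b\<^sup>2 + c\<^sup>2 - a\<^sup>2))) a b c"
proof (rule sdist_scale[OF assms, where k = "\<lambda>a b c. 1 / (4 * a * b * c)"])
  fix a b c :: real assume ac: "acute_triangle a b c"
  then have pos: "0 < a" "0 < b" "0 < c" by (auto simp: acute_triangle_def)
  then show "X16 a b c = 1 / (4 * a * b * c) *
      (a\<^sup>2 * (area4 a b c - sqrt 3 * (b\<^sup>2 + c\<^sup>2 - a\<^sup>2)))"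
    by (simp add: X16_def bary_of_tril_def sin_diff sin_angA[OF ac] cos_angA[OF ac] sin_60 cos_60)
      (simp add: field_simps power2_eq_square)
qed (auto simp: acute_triangle_def)

text \<open>Separate from the scaling statement because the positive factor also carries the sign of
  the coordinate sum from the polynomial form back to the cosine form.\<close>

lemma X36_eq:
  assumes "acute_triangle a b c"
  shows "X36 a b c = 1 / (a * b * c) * (a\<^sup>2 * (b * c - (b\<^sup>2 + c\<^sup>2 - a\<^sup>2)))"
proof -
  have "0 < a" "0 < b" "0 < c" using assms by (auto simp: acute_triangle_def)
  then show ?thesis
    by (simp add: X36_def bary_of_tril_def cos_angA[OF assms] power2_eq_square field_simps)
qed

lemma sdist_X36:
  assumes "acute_triangle a b c"
  shows "sdist X36 a b c = sdist (\<lambda>a b c. a\<^sup>2 * (b * c - (b\<^sup>2 + c\<^sup>2 - a\<^sup>2))) a b c"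
  by (rule sdist_scale[OF assms X36_eq]) (auto simp: acute_triangle_def)

lemma sdist_X24:
  assumes "acute_triangle a b c"
  shows "sdist X24 a b c = sdist (\<lambda>a b c. a * ((1 - 2 * (cA a b c)\<^sup>2) / cA a b c)) a b c"
  by (rule sdist_scale[OF assms, where k = "\<lambda>a b c. - 1"])
    (auto simp: X24_def bary_of_tril_def cos_double_cos diff_divide_distrib right_diff_distrib)

text \<open>A second form of \<open>X34\<close>, purely in the cosine, for the comparison with
  \<open>X24\<close>; the form without cosines serves the comparison with
  \<open>X25\<close>.\<close>

lemma sdist_X34_cos:
  assumes "acute_triangle a b c"
  shows "sdist X34 a b c = sdist (\<lambda>a b c. a * (1 / cA a b c - 1)) a b c"
  by (rule sdist_scale[OF assms, where k = "\<lambda>a b c. - 1"])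
    (auto simp: X34_def bary_of_tril_def right_diff_distrib)

section \<open>Points on the Euler line\<close>

text \<open>The points are combinations of the centroid \<open>1 : 1 : 1\<close> and the orthocenter
  \<open>y * z : z * x : x * y\<close>. The factors \<open>k\<close> and \<open>l\<close> cancel and
  may be negative.\<close>

lemma sdist_euler_line_less:
  fixes a b c x y z :: real
  assumes acute: "acute_triangle a b c"
    and f: "f a b c = k * (\<alpha> - \<beta> * (y * z))" "f b c a = k * (\<alpha> - \<beta> * (z * x))"
      "f c a b = k * (\<alpha> - \<beta> * (x * y))"
    and g: "g a b c = l * (\<gamma> - \<delta> * (y * z))" "g b c a = l * (\<gamma> - \<delta> * (z * x))"
      "g c a b = l * (\<gamma> - \<delta> * (x * y))"
    and scale: "k \<noteq> 0" "l \<noteq> 0"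
    and sums: "0 < 3 * \<alpha> - \<beta> * (x * y + y * z + z * x)" "0 < 3 * \<gamma> - \<delta> * (x * y + y * z + z * x)"
    and less: "\<gamma> * \<beta> < \<alpha> * \<delta>" and yz: "3 * (y * z) < x * y + y * z + z * x"
  shows "sdist f a b c < sdist g a b c"
proof -
  define e where "e = x * y + y * z + z * x"
  have F: "sdist f a b c = (\<alpha> - \<beta> * (y * z)) / (3 * \<alpha> - \<beta> * e) * Ay a b c"
  proof -
    have "f a b c + f b c a + f c a b = k * (3 * \<alpha> - \<beta> * e)"
      by (simp add: f e_def algebra_simps)
    then show ?thesis using scale by (simp add: sdist_def Let_def f(1))
  qed
  have G: "sdist g a b c = (\<gamma> - \<delta> * (y * z)) / (3 * \<gamma> - \<delta> * e) * Ay a b c"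
  proof -
    have "g a b c + g b c a + g c a b = l * (3 * \<gamma> - \<delta> * e)"
      by (simp add: g e_def algebra_simps)
    then show ?thesis using scale by (simp add: sdist_def Let_def g(1))
  qed
  \<comment> \<open>After cross multiplication the terms in \<open>\<alpha> * \<gamma>\<close> and
    \<open>\<beta> * \<delta>\<close> cancel, and exactly this product remains.\<close>
  have "0 < (\<alpha> * \<delta> - \<gamma> * \<beta>) * (e - 3 * (y * z))"
    using less yz by (simp add: e_def)
  also have "\<dots> = (\<alpha> * \<delta> - \<gamma> * \<beta>) * e - 3 * (\<alpha> * \<delta> - \<gamma> * \<beta>) * (y * z)"
    by algebra
  finally have "(\<gamma> - \<delta> * (y * z)) / (3 * \<gamma> - \<delta> * e) > (\<alpha> - \<beta> * (y * z)) / (3 * \<alpha> - \<beta> * e)"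
    using sums unfolding e_def[symmetric]
    by (simp add: divide_less_eq less_divide_eq) (simp add: algebra_simps)
  then show ?thesis
    unfolding F G using Ay_pos[OF acute] by (rule mult_strict_right_mono)
qed

lemma X20_euler:
  assumes "acute_triangle a b c"
    and "x = b\<^sup>2 + c\<^sup>2 - a\<^sup>2" "y = c\<^sup>2 + a\<^sup>2 - b\<^sup>2" "z = a\<^sup>2 + b\<^sup>2 - c\<^sup>2"
  shows "X20 a b c = 1 / (4 * a * b * c) * ((x * y + y * z + z * x) - 2 * (y * z))"
proof -
  have pos: "0 < a" "0 < b" "0 < c" using assms(1) by (auto simp: acute_triangle_def)
  show ?thesis
    unfolding assms(2-4) using pos
    by (simp add: X20_def bary_of_tril_def cos_angA assms(1) acute_triangle_rotate[OF assms(1)]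
        acute_triangle_rotate[OF acute_triangle_rotate[OF assms(1)]] divide_simps) algebra
qed

lemma X22_euler:
  assumes "x = b\<^sup>2 + c\<^sup>2 - a\<^sup>2" "y = c\<^sup>2 + a\<^sup>2 - b\<^sup>2" "z = a\<^sup>2 + b\<^sup>2 - c\<^sup>2"
  shows "X22 a b c = 1 / 4 * (((x + y + z) * (x * y + y * z + z * x) + x * y * z)
    - 2 * (x + y + z) * (y * z))"
  unfolding assms X22_def by algebra

lemma X26_euler:
  assumes "acute_triangle a b c"
    and "x = b\<^sup>2 + c\<^sup>2 - a\<^sup>2" "y = c\<^sup>2 + a\<^sup>2 - b\<^sup>2" "z = a\<^sup>2 + b\<^sup>2 - c\<^sup>2"
  shows "X26 a b c = - 1 / (16 * (a * b * c)\<^sup>2) *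
    (((x + y + z) * (x * y + y * z + z * x)\<^sup>2 + 3 * (x * y + y * z + z * x) * (x * y * z))
     - (3 * (x + y + z) * (x * y + y * z + z * x) + x * y * z) * (y * z))"
proof -
  have pos: "0 < a" "0 < b" "0 < c" using assms(1) by (auto simp: acute_triangle_def)
  have cc: "cA a b c = x / (2 * b * c)" "cB a b c = y / (2 * c * a)" "cC a b c = z / (2 * a * b)"
    using assms(1) acute_triangle_rotate by (simp_all add: cos_angA assms(2-4))
  \<comment> \<open>With the squared sides as half sums of \<open>x\<close>, \<open>y\<close>,
    \<open>z\<close>, everything becomes a polynomial in these three.\<close>
  have sq: "a\<^sup>2 = (y + z) / 2" "b\<^sup>2 = (z + x) / 2" "c\<^sup>2 = (x + y) / 2"
    by (simp_all add: assms(2-4))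
  have "X26 a b c = a * (a * (b\<^sup>2 * (y\<^sup>2 / (2 * c\<^sup>2 * a\<^sup>2) - 1) + c\<^sup>2 * (z\<^sup>2 / (2 * a\<^sup>2 * b\<^sup>2) - 1)
      - a\<^sup>2 * (x\<^sup>2 / (2 * b\<^sup>2 * c\<^sup>2) - 1)))"
    by (simp add: X26_def bary_of_tril_def cos_double_cos cc power_divide power_mult_distrib mult_ac)
  also have "\<dots> = a\<^sup>2 * ((b\<^sup>2)\<^sup>2 * (y\<^sup>2 - 2 * c\<^sup>2 * a\<^sup>2) + (c\<^sup>2)\<^sup>2 * (z\<^sup>2 - 2 * a\<^sup>2 * b\<^sup>2)
      - (a\<^sup>2)\<^sup>2 * (x\<^sup>2 - 2 * b\<^sup>2 * c\<^sup>2)) / (2 * (a * b * c)\<^sup>2)"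
    using pos by (simp add: field_simps power2_eq_square)
  also have "\<dots> = - 1 / (16 * (a * b * c)\<^sup>2) * (- 8 * (a\<^sup>2 * ((b\<^sup>2)\<^sup>2 * (y\<^sup>2 - 2 * c\<^sup>2 * a\<^sup>2)
      + (c\<^sup>2)\<^sup>2 * (z\<^sup>2 - 2 * a\<^sup>2 * b\<^sup>2) - (a\<^sup>2)\<^sup>2 * (x\<^sup>2 - 2 * b\<^sup>2 * c\<^sup>2))))"
    by simp
  also have "- 8 * (a\<^sup>2 * ((b\<^sup>2)\<^sup>2 * (y\<^sup>2 - 2 * c\<^sup>2 * a\<^sup>2)
      + (c\<^sup>2)\<^sup>2 * (z\<^sup>2 - 2 * a\<^sup>2 * b\<^sup>2) - (a\<^sup>2)\<^sup>2 * (x\<^sup>2 - 2 * b\<^sup>2 * c\<^sup>2))) =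
    (((x + y + z) * (x * y + y * z + z * x)\<^sup>2 + 3 * (x * y + y * z + z * x) * (x * y * z))
     - (3 * (x + y + z) * (x * y + y * z + z * x) + x * y * z) * (y * z))"
    unfolding sq by (simp add: field_simps power2_eq_square)
  finally show ?thesis .
qed

section \<open>Auxiliary inequalities\<close>

text \<open>Here \<open>p\<close> is the cosine at \<open>A\<close> and \<open>q\<close> another
  one. Since \<open>(1 - 2 * p\<^sup>2) / p\<close> is the sum of \<open>1 / p - 1\<close> and
  \<open>1 - 2 * p\<close>, the coordinates of \<open>X24\<close> are those of \<open>X34\<close>
  plus those of \<open>X36\<close>, so both differences reduce to the same 2 by 2
  determinant.\<close>

lemma cos_ratio_less:
  fixes p q :: real
  assumes "1 / 2 < p" "p < 1" "0 < q" "q < p"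
  shows "(1 - 2 * p\<^sup>2) / p * (1 / q - 1) < (1 / p - 1) * ((1 - 2 * q\<^sup>2) / q)"
    and "(1 - 2 * p) * ((1 - 2 * q\<^sup>2) / q) < (1 - 2 * p\<^sup>2) / p * (1 - 2 * q)"
proof -
  have "0 < (2 * p - 1) + 2 * q * (1 - p)"
    using assms by (intro add_pos_pos mult_pos_pos) simp_all
  then have "0 < 2 * (p + q) - 1 - 2 * p * q"
    by (simp add: algebra_simps)
  then have key: "0 < (p - q) * (2 * (p + q) - 1 - 2 * p * q)"
    using assms by simp
  have "(1 / p - 1) * ((1 - 2 * q\<^sup>2) / q) - (1 - 2 * p\<^sup>2) / p * (1 / q - 1) =
      (p - q) * (2 * (p + q) - 1 - 2 * p * q) / (p * q)"
    using assms by (simp add: field_simps power2_eq_square)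
  also have "\<dots> > 0" using key assms by simp
  finally show "(1 - 2 * p\<^sup>2) / p * (1 / q - 1) < (1 / p - 1) * ((1 - 2 * q\<^sup>2) / q)" by simp
  have "(1 - 2 * p\<^sup>2) / p * (1 - 2 * q) - (1 - 2 * p) * ((1 - 2 * q\<^sup>2) / q) =
      (p - q) * (2 * (p + q) - 1 - 2 * p * q) / (p * q)"
    using assms by (simp add: field_simps power2_eq_square)
  also have "\<dots> > 0" using key assms by simp
  finally show "(1 - 2 * p) * ((1 - 2 * q\<^sup>2) / q) < (1 - 2 * p\<^sup>2) / p * (1 - 2 * q)" by simp
qed

text \<open>A weak form of the bound with constant 9, for which the remainder is the three square
  terms alone; the constant 5 leaves \<open>4 * (x * y * z)\<close> over and makes it
  strict.\<close>

lemma five_prod_less_sum_mult: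
  fixes x y z :: real
  assumes "0 < x" "0 < y" "0 < z"
  shows "5 * (x * y * z) < (x + y + z) * (x * y + y * z + z * x)"
proof -
  have "(x + y + z) * (x * y + y * z + z * x) - 5 * (x * y * z) =
    4 * (x * y * z) + x * (y - z)\<^sup>2 + y * (z - x)\<^sup>2 + z * (x - y)\<^sup>2"
    by algebra
  also have "\<dots> > 0"
    using assms by (intro add_pos_nonneg mult_nonneg_nonneg) auto
  finally show ?thesis by simp
qed

section \<open>Term by term comparisons when \<open>a\<close> is the shortest side\<close>

context
  fixes a b c :: real
  assumes acute: "acute_triangle a b c" and ab: "a < b" and ac: "a < c"
begin

lemma side_pos: "0 < a" "0 < b" "0 < c" "0 < b + c - a" "0 < c + a - b" "0 < a + b - c"
    "0 < b\<^sup>2 + c\<^sup>2 - a\<^sup>2" "0 < c\<^sup>2 + a\<^sup>2 - b\<^sup>2" "0 < a\<^sup>2 + b\<^sup>2 - c\<^sup>2"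
  using acute by (auto simp: acute_triangle_def)

text \<open>Together with the next two lemmas this supplies the weights, smallest at
  \<open>A\<close>, by which most neighbours in the chain differ.\<close>

lemma side_mult_sum_less: "a * (b + c) < b * (c + a)" "a * (b + c) < c * (a + b)"
  using side_pos ab ac by (auto simp: distrib_left mult.commute)

lemma inverse_side_mult_excess_less:
  "1 / (a * (b + c - a)) < 1 / (b * (c + a - b))" "1 / (a * (b + c - a)) < 1 / (c * (a + b - c))"
proof -
  have "0 < (b - a) * (a + b - c)" "0 < (c - a) * (c + a - b)"
    using ab ac side_pos by simp_all
  then have "b * (c + a - b) < a * (b + c - a)" "c * (a + b - c) < a * (b + c - a)"
    by (simp_all add: algebra_simps)
  then show "1 / (a * (b + c - a)) < 1 / (b * (c + a - b))"
    "1 / (a * (b + c - a)) < 1 / (c * (a + b - c))"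
    using side_pos by (auto intro!: divide_strict_left_mono)
qed

lemma inverse_sum_less: "1 / (b + c) < 1 / (c + a)" "1 / (b + c) < 1 / (a + b)"
  using side_pos ab ac by (auto intro!: divide_strict_left_mono)

lemma X9_less_X8: "sdist X9 a b c < sdist X8 a b c"
  by (rule sdist_less_multiplier[OF acute, where h = "\<lambda>a b c. a"])
    (use side_pos ab ac in \<open>auto simp: X8_def X9_def\<close>)

lemma X10_less_X9: "sdist X10 a b c < sdist X9 a b c"
proof (rule sdist_less_termwise[OF acute])
  have "b * (c + a - b) * (b + c) < a * (b + c - a) * (c + a)"
  proof -
    \<comment> \<open>This product is the difference of the two sides; its second factor is positive
      because the angle at \<open>C\<close> is acute.\<close>
    have "0 < (b - a) * (a\<^sup>2 + b\<^sup>2 - c\<^sup>2)" using ab side_pos by simp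
    then show ?thesis by (simp add: algebra_simps power2_eq_square)
  qed
  then show "X10 a b c * X9 b c a < X9 a b c * X10 b c a" by (simp add: X9_def X10_def mult.commute)
  have "c * (a + b - c) * (b + c) < a * (b + c - a) * (a + b)"
  proof -
    have "0 < (c - a) * (c\<^sup>2 + a\<^sup>2 - b\<^sup>2)" using ac side_pos by simp
    then show ?thesis by (simp add: algebra_simps power2_eq_square)
  qed
  then show "X10 a b c * X9 c a b < X9 a b c * X10 c a b" by (simp add: X9_def X10_def mult.commute)
qed (use side_pos in \<open>auto simp: X9_def X10_def intro!: add_pos_pos\<close>)

lemma X2_less_X10: "sdist X2 a b c < sdist X10 a b c"
  by (rule sdist_less_multiplier[OF acute, where h = "\<lambda>a b c. 1 / (b + c)"])
    (use side_pos inverse_sum_less in \<open>auto simp: X2_def X10_def acute_triangle_def\<close>)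

lemma X37_less_X2: "sdist X37 a b c < sdist X2 a b c"
  by (rule sdist_less_multiplier[OF acute, where h = "\<lambda>a b c. a * (b + c)"])
    (use side_pos side_mult_sum_less in \<open>auto simp: X2_def X37_def\<close>)

lemma X1_less_X37: "sdist X1 a b c < sdist X37 a b c"
  by (rule sdist_less_multiplier[OF acute, where h = "\<lambda>a b c. 1 / (b + c)"])
    (use side_pos inverse_sum_less in \<open>auto simp: X1_def X37_def acute_triangle_def\<close>)

lemma X7_less_X1: "sdist X7 a b c < sdist X1 a b c"
  by (rule sdist_less_multiplier[OF acute, where h = "\<lambda>a b c. 1 / (a * (b + c - a))"])
    (use side_pos inverse_side_mult_excess_less in \<open>auto simp: X1_def X7_def acute_triangle_def\<close>)

lemma X33_less_X29: "sdist X33 a b c < sdist X29 a b c"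
  unfolding sdist_X33[OF acute] sdist_X29[OF acute]
  by (rule sdist_less_multiplier[OF acute, where h = "\<lambda>a b c. a * (b + c)"])
    (use side_pos side_mult_sum_less in \<open>auto simp: acute_triangle_def\<close>)

lemma X4_less_X33: "sdist X4 a b c < sdist X33 a b c"
  unfolding sdist_X33[OF acute] sdist_X4
  by (rule sdist_less_multiplier[OF acute, where h = "\<lambda>a b c. 1 / (a * (b + c - a))"])
    (use side_pos inverse_side_mult_excess_less in \<open>auto simp: acute_triangle_def\<close>)

lemma X27_less_X4: "sdist X27 a b c < sdist X4 a b c"
  unfolding sdist_X27[OF acute] sdist_X4
  by (rule sdist_less_multiplier[OF acute, where h = "\<lambda>a b c. 1 / (b + c)"])
    (use side_pos inverse_sum_less in \<open>auto simp: acute_triangle_def\<close>)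

lemma X19_less_X27: "sdist X19 a b c < sdist X27 a b c"
  unfolding sdist_X27[OF acute] sdist_X19[OF acute]
  by (rule sdist_less_multiplier[OF acute, where h = "\<lambda>a b c. a * (b + c)"])
    (use side_pos side_mult_sum_less in \<open>auto simp: acute_triangle_def\<close>)

lemma X28_less_X19: "sdist X28 a b c < sdist X19 a b c"
  unfolding sdist_X28[OF acute] sdist_X19[OF acute]
  by (rule sdist_less_multiplier[OF acute, where h = "\<lambda>a b c. 1 / (b + c)"])
    (use side_pos inverse_sum_less in \<open>auto simp: acute_triangle_def\<close>)

lemma X25_less_X28: "sdist X25 a b c < sdist X28 a b c"
  unfolding sdist_X28[OF acute] sdist_X25[OF acute]
  by (rule sdist_less_multiplier[OF acute, where h = "\<lambda>a b c. a * (b + c)"])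
    (use side_pos side_mult_sum_less in \<open>auto simp: acute_triangle_def power2_eq_square\<close>)

lemma X34_less_X25: "sdist X34 a b c < sdist X25 a b c"
  unfolding sdist_X34[OF acute] sdist_X25[OF acute]
  by (rule sdist_less_multiplier[OF acute, where h = "\<lambda>a b c. 1 / (a * (b + c - a))"])
    (use side_pos inverse_side_mult_excess_less in \<open>auto simp: acute_triangle_def power2_eq_square\<close>)

section \<open>Euler line order and comparisons by polynomial expansion\<close>

text \<open>Swapping \<open>b\<close> and \<open>c\<close> replaces \<open>m\<close> by
  \<open>-m\<close>, so expressions symmetric in \<open>b\<close> and \<open>c\<close> contain only
  even powers of \<open>m\<close>, whose sign is unknown.\<close>

lemma obtain_sides_around_mean:
  obtains t m where "0 < t" "b = a + t + m" "c = a + t - m"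
proof
  show "0 < (b + c) / 2 - a" using ab ac by simp
  show "b = a + ((b + c) / 2 - a) + (b - c) / 2" "c = a + ((b + c) / 2 - a) - (b - c) / 2"
    by (simp_all add: field_simps)
qed

lemma euler_order: "sdist X20 a b c < sdist X26 a b c" "sdist X22 a b c < sdist X20 a b c"
proof -
  define x y z where xyz: "x = b\<^sup>2 + c\<^sup>2 - a\<^sup>2" "y = c\<^sup>2 + a\<^sup>2 - b\<^sup>2" "z = a\<^sup>2 + b\<^sup>2 - c\<^sup>2"
  have xyz_pos: "0 < x" "0 < y" "0 < z" using side_pos by (simp_all add: xyz)
  \<comment> \<open>As \<open>a\<close> is shortest, \<open>x\<close> is the largest of the three,
    hence \<open>y * z\<close> is the smallest product.\<close>
  have "y < x" "z < x" using ab ac side_pos by (simp_all add: xyz power_strict_mono)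
  then have "y * z < z * x" "y * z < x * y" using xyz_pos by simp_all
  then have yz: "3 * (y * z) < x * y + y * z + z * x" by linarith
  have acute': "acute_triangle b c a" "acute_triangle c a b"
    using acute acute_triangle_rotate by blast+
  have X20: "X20 a b c = 1 / (4 * a * b * c) * ((x * y + y * z + z * x) - 2 * (y * z))"
    "X20 b c a = 1 / (4 * a * b * c) * ((x * y + y * z + z * x) - 2 * (z * x))"
    "X20 c a b = 1 / (4 * a * b * c) * ((x * y + y * z + z * x) - 2 * (x * y))"
    using X20_euler[OF acute xyz] X20_euler[OF acute'(1) xyz(2,3,1)] X20_euler[OF acute'(2) xyz(3,1,2)]
    by (simp_all add: ac_simps)
  have X22: "X22 a b c = 1 / 4 * (((x + y + z) * (x * y + y * z + z * x) + x * y * z) - 2 * (x + y + z) * (y * z))"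
    "X22 b c a = 1 / 4 * (((x + y + z) * (x * y + y * z + z * x) + x * y * z) - 2 * (x + y + z) * (z * x))"
    "X22 c a b = 1 / 4 * (((x + y + z) * (x * y + y * z + z * x) + x * y * z) - 2 * (x + y + z) * (x * y))"
    using X22_euler[OF xyz] X22_euler[OF xyz(2,3,1)] X22_euler[OF xyz(3,1,2)]
    by (simp_all add: ac_simps)
  define \<alpha> where "\<alpha> = (x + y + z) * (x * y + y * z + z * x)\<^sup>2 + 3 * (x * y + y * z + z * x) * (x * y * z)"
  define \<beta> where "\<beta> = 3 * (x + y + z) * (x * y + y * z + z * x) + x * y * z"
  have X26: "X26 a b c = - 1 / (16 * (a * b * c)\<^sup>2) * (\<alpha> - \<beta> * (y * z))"
    "X26 b c a = - 1 / (16 * (a * b * c)\<^sup>2) * (\<alpha> - \<beta> * (z * x))"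
    "X26 c a b = - 1 / (16 * (a * b * c)\<^sup>2) * (\<alpha> - \<beta> * (x * y))"
    using X26_euler[OF acute xyz] X26_euler[OF acute'(1) xyz(2,3,1)] X26_euler[OF acute'(2) xyz(3,1,2)]
    unfolding \<alpha>_def \<beta>_def by (simp_all add: ac_simps)
  have e2: "0 < x * y + y * z + z * x" and e3: "0 < x * y * z"
    using xyz_pos by (simp_all add: add_pos_pos)
  show "sdist X20 a b c < sdist X26 a b c"
  proof (rule sdist_euler_line_less[OF acute X20 X26 _ _ _ _ _ yz])
    have "3 * \<alpha> - \<beta> * (x * y + y * z + z * x) = 8 * (x * y + y * z + z * x) * (x * y * z)"
      unfolding \<alpha>_def \<beta>_def by algebra
    then show "0 < 3 * \<alpha> - \<beta> * (x * y + y * z + z * x)" using e2 e3 by simp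
    have "(x * y + y * z + z * x) * \<beta> - \<alpha> * 2 = (x * y + y * z + z * x) *
      ((x + y + z) * (x * y + y * z + z * x) - 5 * (x * y * z))"
      unfolding \<alpha>_def \<beta>_def by algebra
    also have "\<dots> > 0" using e2 five_prod_less_sum_mult[OF xyz_pos] by simp
    finally show "\<alpha> * 2 < (x * y + y * z + z * x) * \<beta>" by simp
    show "0 < 3 * (x * y + y * z + z * x) - 2 * (x * y + y * z + z * x)" using e2 by (simp add: algebra_simps)
  qed (use side_pos in auto)
  show "sdist X22 a b c < sdist X20 a b c"
  proof (rule sdist_euler_line_less[OF acute X22 X20 _ _ _ _ _ yz])
    have "3 * ((x + y + z) * (x * y + y * z + z * x) + x * y * z)
        - 2 * (x + y + z) * (x * y + y * z + z * x) =
      (x + y + z) * (x * y + y * z + z * x) + 3 * (x * y * z)"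
      by algebra
    also have "\<dots> > 0" using e2 e3 xyz_pos by (intro add_pos_pos mult_pos_pos) auto
    finally show "0 < 3 * ((x + y + z) * (x * y + y * z + z * x) + x * y * z)
        - 2 * (x + y + z) * (x * y + y * z + z * x)" .
    show "(x * y + y * z + z * x) * (2 * (x + y + z)) <
        ((x + y + z) * (x * y + y * z + z * x) + x * y * z) * 2"
      using e3 by (simp add: algebra_simps)
    show "0 < 3 * (x * y + y * z + z * x) - 2 * (x * y + y * z + z * x)" using e2 by (simp add: algebra_simps)
  qed (use side_pos in auto)
qed

text \<open>The terms such as \<open>2 * a\<^sup>2 * (b\<^sup>2 + c\<^sup>2 - a\<^sup>2)\<close> add
  up to twice Heron's product, and the subtracted terms take it away once.\<close>

lemma X40_sum:
  "(2 * a\<^sup>2 * (b\<^sup>2 + c\<^sup>2 - a\<^sup>2) - a * ((b + c - a) * (c + a - b) * (a + b - c)))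
   + (2 * b\<^sup>2 * (c\<^sup>2 + a\<^sup>2 - b\<^sup>2) - b * ((c + a - b) * (a + b - c) * (b + c - a)))
   + (2 * c\<^sup>2 * (a\<^sup>2 + b\<^sup>2 - c\<^sup>2) - c * ((a + b - c) * (b + c - a) * (c + a - b)))
   = (a + b + c) * (b + c - a) * (c + a - b) * (a + b - c)"
  by algebra

lemma X8_less_X40: "sdist X8 a b c < sdist X40 a b c"
  unfolding sdist_X40[OF acute]
proof (rule sdist_lessI[OF acute])
  obtain t m where t: "0 < t" and bc: "b = a + t + m" "c = a + t - m" by (rule obtain_sides_around_mean)
  \<comment> \<open>The cross difference is divisible by \<open>a + b + c\<close>; the quotient is
    written with \<open>b + c\<close> where \<open>b + c > a\<close> already shows
    positivity.\<close>
  have "0 < (a + b + c) * (2 * a ^ 3 * t + 4 * m\<^sup>2 * ((b + c)\<^sup>2 - (b + c) * a + a\<^sup>2))"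
  proof -
    have "(b + c)\<^sup>2 - (b + c) * a + a\<^sup>2 = (b + c) * (b + c - a) + a\<^sup>2" by algebra
    then show ?thesis using side_pos t by (intro mult_pos_pos add_pos_nonneg mult_nonneg_nonneg) auto
  qed
  also have "\<dots> = (2 * a\<^sup>2 * (b\<^sup>2 + c\<^sup>2 - a\<^sup>2) - a * ((b + c - a) * (c + a - b) * (a + b - c))) *
      (X8 b c a + X8 c a b)
    - X8 a b c *
      (2 * b\<^sup>2 * (c\<^sup>2 + a\<^sup>2 - b\<^sup>2) - b * ((c + a - b) * (a + b - c) * (b + c - a)) +
       (2 * c\<^sup>2 * (a\<^sup>2 + b\<^sup>2 - c\<^sup>2) - c * ((a + b - c) * (b + c - a) * (c + a - b))))"
    unfolding X8_def bc by algebra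
  finally show "X8 a b c *
      (2 * b\<^sup>2 * (c\<^sup>2 + a\<^sup>2 - b\<^sup>2) - b * ((c + a - b) * (a + b - c) * (b + c - a)) +
       (2 * c\<^sup>2 * (a\<^sup>2 + b\<^sup>2 - c\<^sup>2) - c * ((a + b - c) * (b + c - a) * (c + a - b))))
    < (2 * a\<^sup>2 * (b\<^sup>2 + c\<^sup>2 - a\<^sup>2) - a * ((b + c - a) * (c + a - b) * (a + b - c))) *
      (X8 b c a + X8 c a b)"
    by simp
next
  show "0 < X8 a b c + X8 b c a + X8 c a b" using side_pos by (simp add: X8_def)
qed (use side_pos in \<open>simp add: X40_sum\<close>)

lemma X40_less_X22: "sdist X40 a b c < sdist X22 a b c"
  unfolding sdist_X40[OF acute]
proof (rule sdist_lessI[OF acute])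
  obtain t m where t: "0 < t" and bc: "b = a + t + m" "c = a + t - m" by (rule obtain_sides_around_mean)
  \<comment> \<open>Four times the cross difference, ordered by powers of \<open>m\<^sup>2\<close>.
    The part free of \<open>m\<close> is strictly positive, the rest nonnegative.\<close>
  have "0 < (8 * a^9 * t + 24 * a^8 * t^2 + 48 * a^7 * t^3 + 48 * a^6 * t^4 + 16 * a^5 * t^5)
    + (72 * a^8 + 528 * a^7 * t + 2112 * a^6 * t^2 + 4128 * a^5 * t^3 + 4064 * a^4 * t^4
       + 1984 * a^3 * t^5 + 384 * a^2 * t^6) * m^2
    + (144 * a^6 + 2256 * a^5 * t + 6848 * a^4 * t^2 + 8576 * a^3 * t^3 + 4864 * a^2 * t^4
       + 1024 * a * t^5) * m^4
    + (864 * a^4 + 2752 * a^3 * t + 2944 * a^2 * t^2 + 1024 * a * t^3) * m^6"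
    using side_pos t by (intro add_pos_nonneg mult_nonneg_nonneg add_nonneg_nonneg) auto
  also have "\<dots> = 4 * (X22 a b c *
      (2 * b\<^sup>2 * (c\<^sup>2 + a\<^sup>2 - b\<^sup>2) - b * ((c + a - b) * (a + b - c) * (b + c - a)) +
       (2 * c\<^sup>2 * (a\<^sup>2 + b\<^sup>2 - c\<^sup>2) - c * ((a + b - c) * (b + c - a) * (c + a - b))))
    - (2 * a\<^sup>2 * (b\<^sup>2 + c\<^sup>2 - a\<^sup>2) - a * ((b + c - a) * (c + a - b) * (a + b - c))) *
      (X22 b c a + X22 c a b))"
    unfolding X22_def bc by algebra
  finally show "(2 * a\<^sup>2 * (b\<^sup>2 + c\<^sup>2 - a\<^sup>2) - a * ((b + c - a) * (c + a - b) * (a + b - c))) *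
      (X22 b c a + X22 c a b)
    < X22 a b c *
      (2 * b\<^sup>2 * (c\<^sup>2 + a\<^sup>2 - b\<^sup>2) - b * ((c + a - b) * (a + b - c) * (b + c - a)) +
       (2 * c\<^sup>2 * (a\<^sup>2 + b\<^sup>2 - c\<^sup>2) - c * ((a + b - c) * (b + c - a) * (c + a - b))))"
    by simp
next
  \<comment> \<open>In the Euler line form the sum is
    \<open>(x + y + z) * (x * y + y * z + z * x) + 3 * (x * y * z)\<close>; the first factor is the
    sum of the squared sides and the second is Heron's product.\<close>
  have "4 * (X22 a b c + X22 b c a + X22 c a b) = (a\<^sup>2 + b\<^sup>2 + c\<^sup>2) *
      ((a + b + c) * (b + c - a) * (c + a - b) * (a + b - c))
      + 3 * ((b\<^sup>2 + c\<^sup>2 - a\<^sup>2) * (c\<^sup>2 + a\<^sup>2 - b\<^sup>2) * (a\<^sup>2 + b\<^sup>2 - c\<^sup>2))"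
    unfolding X22_def by algebra
  also have "\<dots> > 0" using side_pos by (intro add_pos_pos mult_pos_pos) auto
  finally show "0 < X22 a b c + X22 b c a + X22 c a b" by simp
qed (use side_pos in \<open>simp add: X40_sum\<close>)

lemma X29_less_X7: "sdist X29 a b c < sdist X7 a b c"
  unfolding sdist_X29[OF acute]
proof (rule sdist_lessI[OF acute])
  define x y z where xyz: "x = b\<^sup>2 + c\<^sup>2 - a\<^sup>2" "y = c\<^sup>2 + a\<^sup>2 - b\<^sup>2" "z = a\<^sup>2 + b\<^sup>2 - c\<^sup>2"
  have xyz_pos: "0 < x" "0 < y" "0 < z" using side_pos by (simp_all add: xyz)
  \<comment> \<open>Numerator of the sum of the \<open>X29\<close> coordinates at \<open>B\<close>
    and \<open>C\<close> over their common denominator.\<close>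
  let ?N = "(c + a - b) * z * (a + b) + (a + b - c) * y * (c + a)"
  obtain t m where t: "0 < t" and bc: "b = a + t + m" "c = a + t - m" by (rule obtain_sides_around_mean)
  have "0 < (4 * a^8 * t + 2 * a^7 * t^2)
    + (58 * a^7 + 392 * a^6 * t + 1440 * a^5 * t^2 + 2480 * a^4 * t^3 + 2080 * a^3 * t^4
       + 832 * a^2 * t^5 + 128 * a * t^6) * m^2
    + (16 * a^5 + 880 * a^4 * t + 2400 * a^3 * t^2 + 2560 * a^2 * t^3 + 1280 * a * t^4
       + 256 * t^5) * m^4
    + (448 * a^3 + 1088 * a^2 * t + 896 * a * t^2 + 256 * t^3) * m^6"
    using side_pos t by (intro add_pos_nonneg mult_nonneg_nonneg add_nonneg_nonneg) auto
  also have "\<dots> = ?N * (x * (b + c) * ((c + a - b) * (a + b - c)))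
      - 2 * a * (b + c - a)\<^sup>2 * (y * z * ((c + a) * (a + b)))"
    unfolding xyz bc by algebra
  finally have key: "2 * a * (b + c - a)\<^sup>2 * (y * z * ((c + a) * (a + b))) <
      ?N * (x * (b + c) * ((c + a - b) * (a + b - c)))"
    by simp
  \<comment> \<open>The two denominators add up to \<open>2 * a\<close>.\<close>
  have "X7 b c a + X7 c a b = 2 * a / ((c + a - b) * (a + b - c))"
    using side_pos by (simp add: X7_def field_simps)
  then have "(b + c - a) / (x * (b + c)) * (X7 b c a + X7 c a b) =
      (2 * a * (b + c - a)\<^sup>2) / (x * (b + c) * ((c + a - b) * (a + b - c))) / (b + c - a)"
    using side_pos by (simp add: power2_eq_square mult.commute mult.left_commute)
  also have "\<dots> < ?N / (y * z * ((c + a) * (a + b))) / (b + c - a)"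
    using key side_pos xyz_pos by (intro divide_strict_right_mono)
      (simp_all add: pos_divide_less_eq pos_less_divide_eq)
  also have "?N / (y * z * ((c + a) * (a + b))) =
      (c + a - b) / (y * (c + a)) + (a + b - c) / (z * (a + b))"
    using side_pos(1-3) xyz_pos by (simp add: add_divide_distrib)
  finally show "(b + c - a) / ((b\<^sup>2 + c\<^sup>2 - a\<^sup>2) * (b + c)) * (X7 b c a + X7 c a b) <
      X7 a b c * ((c + a - b) / ((c\<^sup>2 + a\<^sup>2 - b\<^sup>2) * (c + a)) + (a + b - c) / ((a\<^sup>2 + b\<^sup>2 - c\<^sup>2) * (a + b)))"
    by (simp add: xyz X7_def)
qed (use side_pos in \<open>auto simp: X7_def intro!: add_pos_pos\<close>)

text \<open>The sum vanishes for an equilateral triangle; after removing the factor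
  \<open>a + b + c\<close> it is positive as soon as \<open>t > 0\<close>.\<close>

lemma X36_sum: "0 < a\<^sup>2 * (b * c - (b\<^sup>2 + c\<^sup>2 - a\<^sup>2)) +
    b\<^sup>2 * (c * a - (c\<^sup>2 + a\<^sup>2 - b\<^sup>2)) + c\<^sup>2 * (a * b - (a\<^sup>2 + b\<^sup>2 - c\<^sup>2))"
proof -
  obtain t m where t: "0 < t" and bc: "b = a + t + m" "c = a + t - m" by (rule obtain_sides_around_mean)
  have "0 < (a + b + c) * (a * t\<^sup>2 + (3 * a + 8 * t) * m\<^sup>2)"
    using side_pos t by (intro mult_pos_pos add_pos_nonneg) auto
  also have "\<dots> = a\<^sup>2 * (b * c - (b\<^sup>2 + c\<^sup>2 - a\<^sup>2)) +
    b\<^sup>2 * (c * a - (c\<^sup>2 + a\<^sup>2 - b\<^sup>2)) + c\<^sup>2 * (a * b - (a\<^sup>2 + b\<^sup>2 - c\<^sup>2))"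
    unfolding bc by algebra
  finally show ?thesis .
qed

lemma X16_less_X36: "sdist X16 a b c < sdist X36 a b c"
  unfolding sdist_X16[OF acute] sdist_X36[OF acute]
proof (rule sdist_lessI[OF acute])
  define K where "K = area4 a b c"
  have K: "area4 a b c = K" "area4 b c a = K" "area4 c a b = K"
    using area4_rotate[of b c a] area4_rotate[of c a b] by (simp_all add: K_def)
  have K_pos: "0 < K" and K2: "K\<^sup>2 = (a + b + c) * (b + c - a) * (c + a - b) * (a + b - c)"
    using area4_pos[OF acute] area4_square[OF acute] by (simp_all add: K_def)
  define S where "S = sqrt (3::real)"
  have S: "0 < S" "S\<^sup>2 = 3" by (simp_all add: S_def)
  \<comment> \<open>Weitzenboeck's inequality, strict because the triangle is not equilateral. The
    coordinates of \<open>X16\<close> sum to \<open>K\<close> times its slack.\<close>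
  have "K * S < a\<^sup>2 + b\<^sup>2 + c\<^sup>2"
  proof (rule power2_less_imp_less)
    have "0 < (b\<^sup>2 - a\<^sup>2)\<^sup>2" using ab side_pos by simp
    then have "0 < 2 * ((b\<^sup>2 - a\<^sup>2)\<^sup>2 + (c\<^sup>2 - a\<^sup>2)\<^sup>2 + (b\<^sup>2 - c\<^sup>2)\<^sup>2)"
      by (simp add: add_pos_nonneg)
    also have "\<dots> = (a\<^sup>2 + b\<^sup>2 + c\<^sup>2)\<^sup>2 - (K * S)\<^sup>2"
      unfolding power_mult_distrib K2 S(2) by algebra
    finally show "(K * S)\<^sup>2 < (a\<^sup>2 + b\<^sup>2 + c\<^sup>2)\<^sup>2" by simp
  qed simp
  then have "0 < K * (a\<^sup>2 + b\<^sup>2 + c\<^sup>2 - K * S)" using K_pos by simp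
  also have "\<dots> = a\<^sup>2 * (K - S * (b\<^sup>2 + c\<^sup>2 - a\<^sup>2)) + b\<^sup>2 * (K - S * (c\<^sup>2 + a\<^sup>2 - b\<^sup>2)) +
      c\<^sup>2 * (K - S * (a\<^sup>2 + b\<^sup>2 - c\<^sup>2))"
    using K2 by algebra
  finally show "0 < a\<^sup>2 * (area4 a b c - sqrt 3 * (b\<^sup>2 + c\<^sup>2 - a\<^sup>2)) +
      b\<^sup>2 * (area4 b c a - sqrt 3 * (c\<^sup>2 + a\<^sup>2 - b\<^sup>2)) +
      c\<^sup>2 * (area4 c a b - sqrt 3 * (a\<^sup>2 + b\<^sup>2 - c\<^sup>2))"
    by (simp only: K S_def)
  obtain t m where t: "0 < t" and bc: "b = a + t + m" "c = a + t - m" by (rule obtain_sides_around_mean)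
  \<comment> \<open>The cross difference divided by \<open>a\<^sup>2\<close> is linear in
    \<open>K\<close> and \<open>S\<close>: \<open>- L\<close> is the coefficient of
    \<open>K\<close>, and \<open>b * c * (a + b + c) * R\<close> that of \<open>S\<close>.\<close>
  define L where "L = (6 * a^3 * t + 14 * a^2 * t^2 + 10 * a * t^3 + 2 * t^4)
    + (18 * a^2 + 46 * a * t + 24 * t^2) * m^2 + 6 * m^4"
  define R where "R = (2 * a^2 * t + 2 * a * t^2) + (6 * a + 8 * t) * m^2"
  have "0 \<le> R" unfolding R_def
    using side_pos t by (intro add_nonneg_nonneg mult_nonneg_nonneg) auto
  \<comment> \<open>Both sides are nonnegative multiples of a square root, so squaring removes the
    roots and leaves a polynomial divisible by \<open>a + b + c\<close>.\<close>
  have "K * L < S * (b * c * (a + b + c) * R)"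
  proof (rule power2_less_imp_less)
    have "0 < (a + b + c) * ((32 * a^7 * t^4 + 144 * a^6 * t^5 + 256 * a^5 * t^6 + 224 * a^4 * t^7
         + 96 * a^3 * t^8 + 16 * a^2 * t^9)
      + (96 * a^7 * t^2 + 1088 * a^6 * t^3 + 3888 * a^5 * t^4 + 6496 * a^4 * t^5 + 5664 * a^3 * t^6
         + 2560 * a^2 * t^7 + 528 * a * t^8 + 32 * t^9) * m^2
      + (432 * a^6 * t + 4640 * a^5 * t^2 + 16160 * a^4 * t^3 + 25888 * a^3 * t^4
         + 20768 * a^2 * t^5 + 8000 * a * t^6 + 1152 * t^7) * m^4
      + (432 * a^5 + 5280 * a^4 * t + 18400 * a^3 * t^2 + 27008 * a^2 * t^3 + 17376 * a * t^4
         + 4032 * t^5) * m^6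
      + (1152 * a^3 + 4944 * a^2 * t + 6720 * a * t^2 + 2688 * t^3) * m^8
      + (144 * a + 288 * t) * m^10)"
      using side_pos t by (intro mult_pos_pos[of "a + b + c"] add_pos_nonneg mult_nonneg_nonneg
          add_nonneg_nonneg) auto
    also have "\<dots> = 3 * (b * c * (a + b + c) * R)\<^sup>2
        - (a + b + c) * (b + c - a) * (c + a - b) * (a + b - c) * L\<^sup>2"
      unfolding L_def R_def bc by algebra
    finally show "(K * L)\<^sup>2 < (S * (b * c * (a + b + c) * R))\<^sup>2"
      unfolding power_mult_distrib[of K] power_mult_distrib[of S] K2 S(2) by simp
  qed (use side_pos S \<open>0 \<le> R\<close> in simp)
  then have "0 < a\<^sup>2 * (S * (b * c * (a + b + c) * R) - K * L)" using side_pos by simp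
  also have "\<dots> = a\<^sup>2 * (b * c - (b\<^sup>2 + c\<^sup>2 - a\<^sup>2)) *
      (b\<^sup>2 * (K - S * (c\<^sup>2 + a\<^sup>2 - b\<^sup>2)) + c\<^sup>2 * (K - S * (a\<^sup>2 + b\<^sup>2 - c\<^sup>2)))
    - a\<^sup>2 * (K - S * (b\<^sup>2 + c\<^sup>2 - a\<^sup>2)) *
      (b\<^sup>2 * (c * a - (c\<^sup>2 + a\<^sup>2 - b\<^sup>2)) + c\<^sup>2 * (a * b - (a\<^sup>2 + b\<^sup>2 - c\<^sup>2)))"
    unfolding L_def R_def bc by algebra
  finally show "a\<^sup>2 * (area4 a b c - sqrt 3 * (b\<^sup>2 + c\<^sup>2 - a\<^sup>2)) *
      (b\<^sup>2 * (c * a - (c\<^sup>2 + a\<^sup>2 - b\<^sup>2)) + c\<^sup>2 * (a * b - (a\<^sup>2 + b\<^sup>2 - c\<^sup>2)))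
    < a\<^sup>2 * (b * c - (b\<^sup>2 + c\<^sup>2 - a\<^sup>2)) *
      (b\<^sup>2 * (area4 b c a - sqrt 3 * (c\<^sup>2 + a\<^sup>2 - b\<^sup>2)) +
       c\<^sup>2 * (area4 c a b - sqrt 3 * (a\<^sup>2 + b\<^sup>2 - c\<^sup>2)))"
    by (simp only: K S_def[symmetric])
qed (rule X36_sum)

section \<open>Comparisons in cosine form: \<open>X34\<close>, \<open>X24\<close>,
  \<open>X36\<close>\<close>

text \<open>The angle opposite the shortest side is the smallest, hence below 60 degrees. This
  provides the hypotheses of \<open>cos_ratio_less\<close> with \<open>p\<close> the cosine at
  \<open>A\<close>.\<close>

lemma cos_bounds:
  "0 < cB a b c" "0 < cC a b c" "cB a b c < cA a b c" "cC a b c < cA a b c"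
  "1 / 2 < cA a b c" "cA a b c < 1" "0 < cA a b c"
proof -
  have acute': "acute_triangle b c a" "acute_triangle c a b"
    using acute acute_triangle_rotate by blast+
  show "0 < cB a b c" "0 < cC a b c" "0 < cA a b c"
    using side_pos by (simp_all add: cos_angA acute acute')
  have "0 < (b - a) * ((a + b + c) * (a + b - c))" "0 < (c - a) * ((a + b + c) * (c + a - b))"
    using side_pos ab ac by simp_all
  then have "b * (c\<^sup>2 + a\<^sup>2 - b\<^sup>2) < a * (b\<^sup>2 + c\<^sup>2 - a\<^sup>2)"
    "c * (a\<^sup>2 + b\<^sup>2 - c\<^sup>2) < a * (b\<^sup>2 + c\<^sup>2 - a\<^sup>2)"
    by (simp_all add: algebra_simps power2_eq_square)
  then have "b * (c\<^sup>2 + a\<^sup>2 - b\<^sup>2) / (2 * a * b * c) < a * (b\<^sup>2 + c\<^sup>2 - a\<^sup>2) / (2 * a * b * c)"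
    "c * (a\<^sup>2 + b\<^sup>2 - c\<^sup>2) / (2 * a * b * c) < a * (b\<^sup>2 + c\<^sup>2 - a\<^sup>2) / (2 * a * b * c)"
    using side_pos(1-3) by - (erule divide_strict_right_mono, simp)+
  moreover have "cA a b c = a * (b\<^sup>2 + c\<^sup>2 - a\<^sup>2) / (2 * a * b * c)"
    "cB a b c = b * (c\<^sup>2 + a\<^sup>2 - b\<^sup>2) / (2 * a * b * c)"
    "cC a b c = c * (a\<^sup>2 + b\<^sup>2 - c\<^sup>2) / (2 * a * b * c)"
    using side_pos(1-3) by (simp_all add: cos_angA acute acute')
  ultimately show "cB a b c < cA a b c" "cC a b c < cA a b c"
    by simp_all
  have "b * c < b\<^sup>2 + c\<^sup>2 - a\<^sup>2"
  proof -
    \<comment> \<open>Both cases rewrite \<open>b\<^sup>2 + c\<^sup>2 - a\<^sup>2 - b * c\<close>,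
      grouping so that the larger of \<open>b\<close> and \<open>c\<close> multiplies their
      difference.\<close>
    have "0 < (b - a) * (b + a) + c * (c - b)" if "b \<le> c"
      using that side_pos ab by (intro add_pos_nonneg) simp_all
    moreover have "0 < (c - a) * (c + a) + b * (b - c)" if "c \<le> b"
      using that side_pos ac by (intro add_pos_nonneg) simp_all
    ultimately show ?thesis
      by (cases "b \<le> c") (simp_all add: algebra_simps power2_eq_square)
  qed
  then show "1 / 2 < cA a b c" using side_pos by (simp add: cos_angA acute field_simps)
  have "0 < (c + a - b) * (a + b - c)" using side_pos by simp
  then have "b\<^sup>2 + c\<^sup>2 - a\<^sup>2 < 2 * b * c" by (simp add: algebra_simps power2_eq_square)
  then show "cA a b c < 1" using side_pos by (simp add: cos_angA acute)
qed

lemma X24_sum: "0 < a * ((1 - 2 * (cA a b c)\<^sup>2) / cA a b c) +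
    b * ((1 - 2 * (cB a b c)\<^sup>2) / cB a b c) + c * ((1 - 2 * (cC a b c)\<^sup>2) / cC a b c)"
proof -
  define x y z where xyz: "x = b\<^sup>2 + c\<^sup>2 - a\<^sup>2" "y = c\<^sup>2 + a\<^sup>2 - b\<^sup>2" "z = a\<^sup>2 + b\<^sup>2 - c\<^sup>2"
  have xyz_pos: "0 < x" "0 < y" "0 < z" using side_pos by (simp_all add: xyz)
  have cc: "cA a b c = x / (2 * b * c)" "cB a b c = y / (2 * c * a)" "cC a b c = z / (2 * a * b)"
    using acute acute_triangle_rotate by (simp_all add: cos_angA xyz)
  have "a * ((1 - 2 * (cA a b c)\<^sup>2) / cA a b c) = a\<^sup>2 * (2 * b\<^sup>2 * c\<^sup>2 - x\<^sup>2) / (a * b * c * x)"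
    "b * ((1 - 2 * (cB a b c)\<^sup>2) / cB a b c) = b\<^sup>2 * (2 * c\<^sup>2 * a\<^sup>2 - y\<^sup>2) / (a * b * c * y)"
    "c * ((1 - 2 * (cC a b c)\<^sup>2) / cC a b c) = c\<^sup>2 * (2 * a\<^sup>2 * b\<^sup>2 - z\<^sup>2) / (a * b * c * z)"
    unfolding cc using side_pos xyz_pos by (simp_all add: field_simps power2_eq_square)
  then have "a * ((1 - 2 * (cA a b c)\<^sup>2) / cA a b c) +
      b * ((1 - 2 * (cB a b c)\<^sup>2) / cB a b c) + c * ((1 - 2 * (cC a b c)\<^sup>2) / cC a b c) =
    (y * z * (a\<^sup>2 * (2 * b\<^sup>2 * c\<^sup>2 - x\<^sup>2)) + z * x * (b\<^sup>2 * (2 * c\<^sup>2 * a\<^sup>2 - y\<^sup>2)) +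
     x * y * (c\<^sup>2 * (2 * a\<^sup>2 * b\<^sup>2 - z\<^sup>2))) / (a * b * c * (x * y * z))"
    using side_pos xyz_pos by (simp add: add_divide_distrib)
  \<comment> \<open>The factor that remains is the one that separates \<open>X26\<close> from
    \<open>X20\<close>.\<close>
  also have "y * z * (a\<^sup>2 * (2 * b\<^sup>2 * c\<^sup>2 - x\<^sup>2)) + z * x * (b\<^sup>2 * (2 * c\<^sup>2 * a\<^sup>2 - y\<^sup>2)) +
     x * y * (c\<^sup>2 * (2 * a\<^sup>2 * b\<^sup>2 - z\<^sup>2)) =
     1 / 4 * ((x * y + y * z + z * x) * ((x + y + z) * (x * y + y * z + z * x) - 5 * (x * y * z)))"
  proof -
    have sq: "a\<^sup>2 = (y + z) / 2" "b\<^sup>2 = (z + x) / 2" "c\<^sup>2 = (x + y) / 2"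
      by (simp_all add: xyz)
    show ?thesis unfolding sq by (simp add: field_simps power2_eq_square)
  qed
  also have "0 < \<dots> / (a * b * c * (x * y * z))"
    using side_pos xyz_pos five_prod_less_sum_mult[OF xyz_pos] by (simp add: add_pos_pos)
  finally show ?thesis .
qed

lemma X24_less_X34: "sdist X24 a b c < sdist X34 a b c"
  unfolding sdist_X24[OF acute] sdist_X34_cos[OF acute]
proof (rule sdist_less_termwise[OF acute])
  show "0 < a * (1 / cA a b c - 1) + b * (1 / cB a b c - 1) + c * (1 / cC a b c - 1)"
    using cos_bounds side_pos by (intro add_pos_pos mult_pos_pos) simp_all
  have "0 < a * b" "0 < a * c" using side_pos by simp_all
  then show "a * ((1 - 2 * (cA a b c)\<^sup>2) / cA a b c) * (b * (1 / cB a b c - 1)) <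
      a * (1 / cA a b c - 1) * (b * ((1 - 2 * (cB a b c)\<^sup>2) / cB a b c))"
    "a * ((1 - 2 * (cA a b c)\<^sup>2) / cA a b c) * (c * (1 / cC a b c - 1)) <
      a * (1 / cA a b c - 1) * (c * ((1 - 2 * (cC a b c)\<^sup>2) / cC a b c))"
    using mult_strict_left_mono[OF cos_ratio_less(1)[of "cA a b c" "cB a b c"], of "a * b"]
      mult_strict_left_mono[OF cos_ratio_less(1)[of "cA a b c" "cC a b c"], of "a * c"] cos_bounds
    by (simp_all only: mult_ac)
qed (rule X24_sum)

lemma X36_less_X24: "sdist X36 a b c < sdist X24 a b c"
  unfolding sdist_X24[OF acute]
proof (rule sdist_less_termwise[OF acute])
  have acute': "acute_triangle b c a" "acute_triangle c a b"
    using acute acute_triangle_rotate by blast+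
  \<comment> \<open>\<open>X36\<close> stays in cosine form for the termwise comparison; only the
    sign of its sum is read off from the polynomial form.\<close>
  have "X36 a b c + X36 b c a + X36 c a b = 1 / (a * b * c) *
      (a\<^sup>2 * (b * c - (b\<^sup>2 + c\<^sup>2 - a\<^sup>2)) +
       b\<^sup>2 * (c * a - (c\<^sup>2 + a\<^sup>2 - b\<^sup>2)) + c\<^sup>2 * (a * b - (a\<^sup>2 + b\<^sup>2 - c\<^sup>2)))"
    using X36_eq[OF acute] X36_eq[OF acute'(1)] X36_eq[OF acute'(2)]
    by (simp add: distrib_left mult_ac)
  also have "\<dots> > 0" using X36_sum side_pos by simp
  finally show "0 < X36 a b c + X36 b c a + X36 c a b" .
  have "0 < a * b" "0 < a * c" using side_pos by simp_all
  then show "X36 a b c * (b * ((1 - 2 * (cB a b c)\<^sup>2) / cB a b c)) <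
      a * ((1 - 2 * (cA a b c)\<^sup>2) / cA a b c) * X36 b c a"
    "X36 a b c * (c * ((1 - 2 * (cC a b c)\<^sup>2) / cC a b c)) <
      a * ((1 - 2 * (cA a b c)\<^sup>2) / cA a b c) * X36 c a b"
    using mult_strict_left_mono[OF cos_ratio_less(2)[of "cA a b c" "cB a b c"], of "a * b"]
      mult_strict_left_mono[OF cos_ratio_less(2)[of "cA a b c" "cC a b c"], of "a * c"] cos_bounds
    by (simp_all only: X36_def bary_of_tril_def mult_ac)
qed (rule X24_sum)

end

theorem theorem5p1:
  fixes a b c :: real
  assumes "acute_triangle a b c" and "a < b" and "a < c"
  shows "sdist X26 a b c > sdist X20 a b c \<and> sdist X20 a b c > sdist X22 a b c \<and>
         sdist X22 a b c > sdist X40 a b c \<and> sdist X40 a b c > sdist X8 a b c \<and>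
         sdist X8 a b c > sdist X9 a b c \<and> sdist X9 a b c > sdist X10 a b c \<and>
         sdist X10 a b c > sdist X2 a b c \<and> sdist X2 a b c > sdist X37 a b c \<and>
         sdist X37 a b c > sdist X1 a b c \<and> sdist X1 a b c > sdist X7 a b c \<and>
         sdist X7 a b c > sdist X29 a b c \<and> sdist X29 a b c > sdist X33 a b c \<and>
         sdist X33 a b c > sdist X4 a b c \<and> sdist X4 a b c > sdist X27 a b c \<and>
         sdist X27 a b c > sdist X19 a b c \<and> sdist X19 a b c > sdist X28 a b c \<and>
         sdist X28 a b c > sdist X25 a b c \<and> sdist X25 a b c > sdist X34 a b c \<and>
         sdist X34 a b c > sdist X24 a b c \<and> sdist X24 a b c > sdist X36 a b c \<and>
         sdist X36 a b c > sdist X16 a b c"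
  using euler_order[OF assms] X40_less_X22[OF assms] X8_less_X40[OF assms] X9_less_X8[OF assms]
    X10_less_X9[OF assms] X2_less_X10[OF assms] X37_less_X2[OF assms] X1_less_X37[OF assms]
    X7_less_X1[OF assms] X29_less_X7[OF assms] X33_less_X29[OF assms] X4_less_X33[OF assms]
    X27_less_X4[OF assms] X19_less_X27[OF assms] X28_less_X19[OF assms] X25_less_X28[OF assms]
    X34_less_X25[OF assms] X24_less_X34[OF assms] X36_less_X24[OF assms] X16_less_X36[OF assms]
  by blast

end
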